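(* Let $m_i,m_j>0$, let $e\in[0,1]$ be the restitution coefficient, and let $p>1$. For velocities $v,v_*\in\mathbb{R}^d$ set $u=v-v_*$. There are constants $k_p>0$ and $A_p>0$ (independent of $v,v_*$) such that, taking $\psi(x)=x^p$, $$|u|\,\bar q[\psi](v,v_* )\le -k_p\big(m_i|v|^{2p+1}+m_j|v_*|^{2p+1}\big)+A_p\big(m_im_j^p\,|v|\,|v_*|^{2p}+m_jm_i^p\,|v|^{2p}|v_*|\big).$$ Moreover, taking $\psi(x)=(1+x)^p-1$ yields (with constants $k_p,A_p>0$ depending on this choice of $\psi$) $$|u|\,\bar q[\psi](v,v_* )\le -k_p\big(m_i\langle v\rangle_i^{2p+1}+m_j\langle v_*\rangle_j^{2p+1}\big)+A_p\big(m_im_j^p\,\langle v\rangle_i\langle v_*\rangle_j^{2p}+m_jm_i^p\,\langle v\rangle_i^{2p}\langle v_*\rangle_j\big).$$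
   Context: Here $\langle v\rangle_i=(1+m_i|v|^2)^{1/2}$. For $\sigma\in\mathbb{S}^{d-1}$ the post-collisional velocities are $$v'=\frac{m_iv+m_jv_*}{m_i+m_j}+\frac{m_j}{m_i+m_j}\Big[\frac{1-e}{2}u+\frac{1+e}{2}|u|\sigma\Big],\qquad v_*'=\frac{m_iv+m_jv_*}{m_i+m_j}-\frac{m_i}{m_i+m_j}\Big[\frac{1-e}{2}u+\frac{1+e}{2}|u|\sigma\Big].$$ Define $$q[\psi](v,v_*,\sigma)=\psi(m_i|v'|^2)+\psi(m_j|v_*'|^2)-\psi(m_i|v|^2)-\psi(m_j|v_*|^2),\qquad \bar q[\psi](v,v_* )=\int_{\mathbb{S}^{d-1}}q[\psi](v,v_*,\sigma)\,b(\cos\theta)\,d\sigma,$$ where $\theta$ is the angle between $u$ and $\sigma$, and the angular cross section $b$ satisfies $0<\beta_1\le b\le\beta_2<\infty$ on $[-1,1]$. *)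

theory Defs
  imports "HOL-Analysis.Analysis"
begin

(* Surface measure on the unit sphere, as the cone measure: the measure of A is DIM('a) times
   the Lebesgue volume of the punctured cone of all r *\<^sub>R s with 0 < r < 1 and s in A.
   Recall sgn x = x / |x|. *)
definition sphere_measure :: "'a::euclidean_space measure" where
  "sphere_measure =
     scale_measure (of_nat DIM('a))
       (distr (restrict_space lborel (ball 0 1 - {0})) (restrict_space borel (sphere 0 1)) sgn)"

lemma space_sphere_measure [simp]:
  "space (sphere_measure :: 'a::euclidean_space measure) = sphere 0 1"
  by (simp add: sphere_measure_def space_scale_measure space_restrict_space)

lemma sets_sphere_measure [simp, measurable_cong]:
  "sets (sphere_measure :: 'a::euclidean_space measure) = sets (restrict_space borel (sphere 0 1))"
  by (simp add: sphere_measure_def)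

lemma measurable_sgn_sphere:
  "sgn \<in> restrict_space lborel (ball 0 1 - {0 :: 'a::euclidean_space})
           \<rightarrow>\<^sub>M restrict_space borel (sphere 0 1)"
proof (rule measurable_restrict_space2)
  show "sgn \<in> space (restrict_space lborel (ball 0 1 - {0 :: 'a})) \<rightarrow> sphere 0 1"
    by (auto simp: space_restrict_space norm_sgn)
  have "sgn = (\<lambda>x :: 'a. x /\<^sub>R norm x)"
    by (auto simp: sgn_div_norm)
  then show "sgn \<in> borel_measurable (restrict_space lborel (ball 0 1 - {0 :: 'a}))"
    by (intro measurable_restrict_space1) simp
qed

lemma emeasure_sphere_measure:
  fixes A :: "'a::euclidean_space set"
  assumes "A \<in> sets (restrict_space borel (sphere 0 1))"
  shows "emeasure sphere_measure A =
           of_nat DIM('a) * emeasure lborel {x \<in> ball 0 1 - {0}. sgn x \<in> A}"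
proof -
  have "sgn -` A \<inter> space (restrict_space lborel (ball 0 1 - {0})) =
          {x \<in> ball 0 1 - {0 :: 'a}. sgn x \<in> A}"
    by (auto simp: space_restrict_space)
  moreover have "emeasure (restrict_space lborel (ball 0 1 - {0})) {x \<in> ball 0 1 - {0 :: 'a}. sgn x \<in> A} =
                   emeasure lborel {x \<in> ball 0 1 - {0}. sgn x \<in> A}"
    by (rule emeasure_restrict_space) auto
  ultimately show ?thesis
    unfolding sphere_measure_def emeasure_scale_measure
      emeasure_distr [OF measurable_sgn_sphere assms] by metis
qed

lemma emeasure_sphere_measure_sphere:
  "emeasure sphere_measure (sphere 0 1 :: 'a::euclidean_space set) =
     of_nat DIM('a) * emeasure lborel (ball (0 :: 'a) 1)"
proof -
  have "sphere 0 1 \<in> sets (restrict_space borel (sphere (0 :: 'a) 1))"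
    by (auto simp: sets_restrict_space image_iff intro!: bexI[of _ UNIV])
  moreover have "{x \<in> ball 0 1 - {0}. sgn x \<in> sphere (0 :: 'a) 1} = ball 0 1 - {0}"
    by (auto simp: norm_sgn)
  moreover have "emeasure lborel (ball 0 1 - {0 :: 'a}) = emeasure lborel (ball (0 :: 'a) 1)"
    by (rule emeasure_Diff_null_set) (auto simp: null_sets_def)
  ultimately show ?thesis
    by (simp add: emeasure_sphere_measure)
qed

definition post_v :: "real \<Rightarrow> real \<Rightarrow> real \<Rightarrow> 'a \<Rightarrow> 'a \<Rightarrow> 'a \<Rightarrow> 'a::euclidean_space" where
  "post_v mi mj e v vs \<sigma> =
     (mi *\<^sub>R v + mj *\<^sub>R vs) /\<^sub>R (mi + mj)
     + (mj / (mi + mj)) *\<^sub>R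
         (((1 - e) / 2) *\<^sub>R (v - vs) + ((1 + e) / 2 * norm (v - vs)) *\<^sub>R \<sigma>)"

definition post_vs :: "real \<Rightarrow> real \<Rightarrow> real \<Rightarrow> 'a \<Rightarrow> 'a \<Rightarrow> 'a \<Rightarrow> 'a::euclidean_space" where
  "post_vs mi mj e v vs \<sigma> =
     (mi *\<^sub>R v + mj *\<^sub>R vs) /\<^sub>R (mi + mj)
     - (mi / (mi + mj)) *\<^sub>R
         (((1 - e) / 2) *\<^sub>R (v - vs) + ((1 + e) / 2 * norm (v - vs)) *\<^sub>R \<sigma>)"

definition q ::
  "real \<Rightarrow> real \<Rightarrow> real \<Rightarrow> (real \<Rightarrow> real) \<Rightarrow> 'a \<Rightarrow> 'a \<Rightarrow> 'a::euclidean_space \<Rightarrow> real" where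
  "q mi mj e \<psi> v vs \<sigma> =
     \<psi> (mi * (norm (post_v mi mj e v vs \<sigma>))\<^sup>2) + \<psi> (mj * (norm (post_vs mi mj e v vs \<sigma>))\<^sup>2)
     - \<psi> (mi * (norm v)\<^sup>2) - \<psi> (mj * (norm vs)\<^sup>2)"

(* If x or y is 0 there is no angle; division by zero then gives the value 0. *)
definition cos_angle :: "'a::euclidean_space \<Rightarrow> 'a \<Rightarrow> real" where
  "cos_angle x y = (x \<bullet> y) / (norm x * norm y)"

definition q_bar ::
  "real \<Rightarrow> real \<Rightarrow> real \<Rightarrow> (real \<Rightarrow> real) \<Rightarrow> (real \<Rightarrow> real) \<Rightarrow> 'a \<Rightarrow> 'a::euclidean_space \<Rightarrow> real" where
  "q_bar mi mj e b \<psi> v vs =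
     (\<integral>\<sigma>. q mi mj e \<psi> v vs \<sigma> * b (cos_angle (v - vs) \<sigma>) \<partial>sphere_measure)"

definition bracket :: "real \<Rightarrow> 'a::euclidean_space \<Rightarrow> real" where
  "bracket m v = sqrt (1 + m * (norm v)\<^sup>2)"

end

theory Submission
  imports Defs
begin

text \<open>
  With \<open>\<psi> x = (\<eta> + x) powr p\<close> both estimates are one statement, \<open>\<eta> = 0\<close> giving the first and
  \<open>\<eta> = 1\<close> the second. It is homogeneous under \<open>(\<eta>, v, vs) \<mapsto> (l\<^sup>2 \<eta>, l v, l vs)\<close>, so it
  suffices to treat the compact set \<open>2 \<eta> + mi |v|\<^sup>2 + mj |vs|\<^sup>2 = 1\<close>. There the left-hand side is
  dominated by a continuous function \<open>F\<close>, while the positive terms on the right dominate a multiple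
  of the product \<open>g\<close> of the two brackets. Where \<open>g = 0\<close>, one particle is at rest, \<open>\<eta> = 0\<close> and
  the other carries unit energy; energy dissipation and strict convexity of \<open>x powr p\<close> then force
  \<open>F < 0\<close>. By compactness \<open>F \<le> - k + A g\<close>.
\<close>

section \<open>Scaling of powers and a compactness principle\<close>

lemma powr_scale_square:
  fixes l p x y :: real
  assumes "0 \<le> l" "0 \<le> x" "0 \<le> y"
  shows "(l\<^sup>2 * x + l\<^sup>2 * y) powr p = l powr (2 * p) * (x + y) powr p"
proof -
  have "(l\<^sup>2 * x + l\<^sup>2 * y) powr p = (l\<^sup>2 * (x + y)) powr p"
    by (simp add: algebra_simps)
  also have "\<dots> = (l\<^sup>2) powr p * (x + y) powr p"
    using assms by (simp add: powr_mult)
  also have "(l\<^sup>2) powr p = l powr (2 * p)"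
    using assms by (cases "l = 0") (auto simp flip: powr_numeral simp: powr_powr)
  finally show ?thesis .
qed

text \<open>Compactness is used twice. On the zero set of \<open>g\<close> the maximum of
  \<open>F\<close> is negative. On the compact part of \<open>K\<close> where \<open>F\<close> is
  not yet below \<open>- k\<close>, \<open>g\<close> has a positive minimum, so a large multiple of
  \<open>g\<close> absorbs \<open>F\<close> there; elsewhere \<open>g \<ge> 0\<close>
  suffices.\<close>

lemma compact_le_neg_const_plus_mult:
  fixes F g :: "'a::topological_space \<Rightarrow> real"
  assumes K: "compact K" and F: "continuous_on K F" and g: "continuous_on K g"
    and nonneg: "\<And>z. z \<in> K \<Longrightarrow> 0 \<le> g z"
    and neg: "\<And>z. z \<in> K \<Longrightarrow> g z = 0 \<Longrightarrow> F z < 0"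
  obtains k A where "k > 0" "A > 0" "\<And>z. z \<in> K \<Longrightarrow> F z \<le> - k + A * g z"
proof -
  have "compact (K \<inter> g -` {..0})"
    by (rule closedin_compact[OF K]) (rule continuous_closedin_preimage[OF g closed_atMost])
  moreover have "continuous_on (K \<inter> g -` {..0}) F"
    using F continuous_on_subset by blast
  ultimately obtain k where k: "k > 0" "\<And>z. z \<in> K \<Longrightarrow> g z = 0 \<Longrightarrow> F z \<le> - 2 * k"
  proof (cases "K \<inter> g -` {..0} = {}")
    case True
    then have "F z \<le> - 2 * 1" if "z \<in> K" "g z = 0" for z
      using that by fastforce
    then show ?thesis
      using that[of 1] by auto
  next
    case False
    obtain z0 where z0: "z0 \<in> K \<inter> g -` {..0}" "\<And>z. z \<in> K \<inter> g -` {..0} \<Longrightarrow> F z \<le> F z0"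
      using continuous_attains_sup[of "K \<inter> g -` {..0}" F] False
        \<open>compact (K \<inter> g -` {..0})\<close> \<open>continuous_on (K \<inter> g -` {..0}) F\<close> by blast
    moreover have "g z0 = 0"
      using nonneg[of z0] z0(1) by auto
    ultimately have "F z0 < 0"
      using neg by auto
    moreover have "F z \<le> - 2 * (- F z0 / 2)" if "z \<in> K" "g z = 0" for z
      using z0(2)[of z] that by auto
    ultimately show ?thesis
      using that[of "- F z0 / 2"] by auto
  qed
  \<comment> \<open>The margin between \<open>- 2 * k\<close> and \<open>- k\<close> keeps the zero
    set of \<open>g\<close> out of \<open>L\<close>.\<close>
  define L where "L = K \<inter> F -` {- k..}"
  have "compact L"
    unfolding L_def
    by (rule closedin_compact[OF K]) (rule continuous_closedin_preimage[OF F closed_atLeast])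
  moreover have "continuous_on L g" "continuous_on L F"
    using F g continuous_on_subset unfolding L_def by blast+
  ultimately obtain A where A: "A > 0" "\<And>z. z \<in> L \<Longrightarrow> F z \<le> - k + A * g z"
  proof (cases "L = {}")
    case True
    then show ?thesis
      using that[of 1] by auto
  next
    case False
    obtain z0 where z0: "z0 \<in> L" "\<And>z. z \<in> L \<Longrightarrow> g z0 \<le> g z"
      using continuous_attains_inf[OF \<open>compact L\<close> False \<open>continuous_on L g\<close>] by blast
    obtain z1 where z1: "z1 \<in> L" "\<And>z. z \<in> L \<Longrightarrow> F z \<le> F z1"
      using continuous_attains_sup[OF \<open>compact L\<close> False \<open>continuous_on L F\<close>] by blast
    have pos: "g z0 > 0"
      using z0(1) nonneg[of z0] k(2)[of z0] k(1) by (cases "g z0 = 0") (auto simp: L_def)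
    \<comment> \<open>Chosen so that \<open>- k + A * g z0\<close> equals
      \<open>\<bar>F z1\<bar>\<close>, which is at least the maximum \<open>F z1\<close> of
      \<open>F\<close> on \<open>L\<close>.\<close>
    define A where "A = (\<bar>F z1\<bar> + k) / g z0"
    have "A > 0"
      using pos k(1) by (auto simp: A_def intro!: divide_pos_pos)
    moreover have "F z \<le> - k + A * g z" if "z \<in> L" for z
    proof -
      have "F z \<le> - k + A * g z0"
        using z1(2)[OF that] pos by (simp add: A_def)
      also have "A * g z0 \<le> A * g z"
        using z0(2)[OF that] \<open>A > 0\<close> by simp
      finally show ?thesis by simp
    qed
    ultimately show ?thesis
      using that by blast
  qed
  have "F z \<le> - k + A * g z" if "z \<in> K" for z
  proof (cases "z \<in> L")
    case False
    then have "F z < - k"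
      using that by (auto simp: L_def)
    moreover have "0 \<le> A * g z"
      using A(1) nonneg[OF that] by simp
    ultimately show ?thesis by linarith
  qed (use A in auto)
  then show ?thesis
    using that k(1) A(1) by blast
qed

section \<open>Integration over the unit sphere\<close>

lemma finite_sphere_measure: "finite_measure (sphere_measure :: 'a::euclidean_space measure)"
proof
  have "emeasure lborel (ball (0::'a) 1) < \<infinity>"
    by (rule emeasure_bounded_finite) auto
  then show "emeasure (sphere_measure :: 'a measure) (space sphere_measure) \<noteq> \<infinity>"
    by (simp add: emeasure_sphere_measure_sphere ennreal_mult_eq_top_iff)
qed

lemma borel_measurable_sphere_continuous:
  fixes f :: "'a::euclidean_space \<Rightarrow> real"
  assumes "continuous_on (sphere 0 1) f"
  shows "f \<in> borel_measurable sphere_measure"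
  using borel_measurable_continuous_on_restrict[OF assms]
  by (simp cong: measurable_cong_sets)

lemma integrable_sphere_bounded:
  fixes f :: "'a::euclidean_space \<Rightarrow> real"
  assumes "f \<in> borel_measurable sphere_measure" and "\<And>s. s \<in> sphere 0 1 \<Longrightarrow> \<bar>f s\<bar> \<le> C"
  shows "integrable sphere_measure f"
  by (rule finite_measure.integrable_const_bound[OF finite_sphere_measure, of _ C])
     (use assms in \<open>auto intro!: AE_I2\<close>)

text \<open>Dominated convergence along sequences: \<open>f\<close> is bounded on the compact
  product \<open>K \<times> sphere 0 1\<close>, and a constant is integrable because the sphere has
  finite measure.\<close>

lemma continuous_on_sphere_integral:
  fixes f :: "'b::euclidean_space \<Rightarrow> 'a::euclidean_space \<Rightarrow> real"
  assumes K: "compact K" and f: "continuous_on (K \<times> sphere 0 1) (\<lambda>(z, s). f z s)"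
  shows "continuous_on K (\<lambda>z. \<integral>s. f z s \<partial>sphere_measure)"
  unfolding continuous_on_sequentially
proof safe
  fix X z assume z: "z \<in> K" and X: "\<forall>n. X n \<in> K" "X \<longlonglongrightarrow> z"
  have "bounded ((\<lambda>(z, s). f z s) ` (K \<times> sphere 0 1))"
    by (intro compact_imp_bounded compact_continuous_image f compact_Times K compact_sphere)
  then obtain C where C: "\<And>z s. z \<in> K \<Longrightarrow> s \<in> sphere 0 1 \<Longrightarrow> \<bar>f z s\<bar> \<le> C"
    unfolding bounded_iff real_norm_def by fast
  have slice: "continuous_on (sphere 0 1) (f z)" if "z \<in> K" for z
    using continuous_on_compose2[OF f, of "sphere 0 1" "Pair z"] that
    by (auto simp: continuous_on_Pair)
  have "(\<lambda>n. \<integral>s. f (X n) s \<partial>sphere_measure) \<longlonglongrightarrow> (\<integral>s. f z s \<partial>sphere_measure)"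
  proof (rule integral_dominated_convergence[where w = "\<lambda>_. C"])
    show "integrable (sphere_measure :: 'a measure) (\<lambda>_. C)"
      by (rule finite_measure.integrable_const[OF finite_sphere_measure])
    show "AE s in sphere_measure. (\<lambda>n. f (X n) s) \<longlonglongrightarrow> f z s"
    proof (rule AE_I2)
      fix s :: 'a assume "s \<in> space sphere_measure"
      then have "(\<lambda>z. (z, s)) ` K \<subseteq> K \<times> sphere 0 1"
        by auto
      then have "continuous_on K (\<lambda>z. f z s)"
        using continuous_on_compose2[OF f, of K "\<lambda>z. (z, s)"]
        by (simp add: continuous_on_Pair)
      then show "(\<lambda>n. f (X n) s) \<longlonglongrightarrow> f z s"
        using X z unfolding continuous_on_sequentially comp_def by blast
    qed
  qed (use X z C in \<open>auto intro!: borel_measurable_sphere_continuous slice AE_I2\<close>)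
  then show "((\<lambda>z. \<integral>s. f z s \<partial>sphere_measure) \<circ> X) \<longlonglongrightarrow> (\<integral>s. f z s \<partial>sphere_measure)"
    by (simp add: comp_def)
qed

text \<open>If the integral vanished, \<open>f\<close> would be zero almost everywhere on the
  sphere. By the cone formula for \<open>sphere_measure\<close>, the cone over the points with
  \<open>f s \<noteq> 0\<close> would then be Lebesgue null; but that cone is open and, because of
  \<open>s0\<close>, nonempty.\<close>

lemma sphere_integral_neg:
  fixes f :: "'a::euclidean_space \<Rightarrow> real"
  assumes f: "continuous_on (sphere 0 1) f"
    and nonpos: "\<And>s. s \<in> sphere 0 1 \<Longrightarrow> f s \<le> 0"
    and s0: "s0 \<in> sphere 0 1" "f s0 < 0"
  shows "(\<integral>s. f s \<partial>sphere_measure) < 0"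
proof (rule ccontr)
  assume "\<not> (\<integral>s. f s \<partial>sphere_measure) < 0"
  moreover have "0 \<le> (\<integral>s. - f s \<partial>sphere_measure)"
    using nonpos by (intro Bochner_Integration.integral_nonneg) auto
  ultimately have zero: "(\<integral>s. - f s \<partial>sphere_measure) = 0"
    by simp
  have m: "f \<in> borel_measurable sphere_measure"
    by (rule borel_measurable_sphere_continuous[OF f])
  have "bounded (f ` sphere 0 1)"
    by (intro compact_imp_bounded compact_continuous_image f compact_sphere)
  then obtain C where C: "\<And>s. s \<in> sphere 0 1 \<Longrightarrow> \<bar>f s\<bar> \<le> C"
    unfolding bounded_iff real_norm_def by blast
  have "integrable sphere_measure (\<lambda>s. - f s)"
    using integrable_sphere_bounded[OF m C] by simp
  moreover have "AE s in sphere_measure. 0 \<le> - f s"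
    using nonpos by (intro AE_I2) simp
  ultimately have "AE s in sphere_measure. - f s = 0"
    using integral_nonneg_eq_0_iff_AE[of sphere_measure "\<lambda>s. - f s"] zero by blast
  moreover have meas: "{s \<in> space sphere_measure. \<not> (- f s = 0)} \<in> sets sphere_measure"
    using measurable_sets[OF m, of "- {0}"] by (simp add: vimage_def Int_def conj_commute)
  ultimately have "emeasure sphere_measure {s \<in> space sphere_measure. \<not> (- f s = 0)} = 0"
    by (simp only: AE_iff_measurable[OF meas refl])
  with meas have null: "emeasure lborel {x \<in> ball 0 1 - {0::'a}. sgn x \<in> {s \<in> sphere 0 1. f s \<noteq> 0}} = 0"
    by (simp add: emeasure_sphere_measure)
  define U where "U = {x \<in> ball 0 1 - {0::'a}. sgn x \<in> {s \<in> sphere 0 1. f s \<noteq> 0}}"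
  have "continuous_on (ball 0 1 - {0}) (\<lambda>x. f (sgn x))"
    by (rule continuous_on_compose2[OF f])
      (auto intro!: continuous_intros simp: norm_sgn split: if_splits)
  then have "open ((ball 0 1 - {0}) \<inter> (\<lambda>x. f (sgn x)) -` (- {0}))"
    by (rule continuous_open_preimage) auto
  also have "(ball 0 1 - {0}) \<inter> (\<lambda>x. f (sgn x)) -` (- {0}) = U"
    by (auto simp: U_def norm_sgn)
  finally have "open U" .
  \<comment> \<open>Halving keeps the direction of \<open>s0\<close> and moves it into the punctured
    ball.\<close>
  moreover have "s0 /\<^sub>R 2 \<in> U"
    using s0 by (auto simp: U_def sgn_div_norm)
  ultimately have "\<not> negligible U"
    using open_not_negligible by blast
  moreover have "U \<in> null_sets lborel"
    using null \<open>open U\<close> by (auto simp: null_sets_def U_def)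
  ultimately show False
    by (meson negligible_iff_null_sets null_sets_completionI)
qed

section \<open>Collision mechanics and energy\<close>

text \<open>Exchanging the particles reverses the relative velocity, so the scattering direction has
  to change sign as well.\<close>

lemma post_vs_eq_post_v: "post_vs mi mj e v vs s = post_v mj mi e vs v (- s)"
  by (simp add: post_v_def post_vs_def norm_minus_commute algebra_simps)

text \<open>Koenig's decomposition: \<open>c\<close> is the velocity of the centre of mass,
  \<open>w\<close> the relative velocity, and \<open>mi * mj / (mi + mj)\<close> the reduced
  mass.\<close>

lemma energy_center_of_mass:
  fixes c w :: "'a::real_inner"
  assumes "mi > 0" "mj > 0"
  shows "mi * (norm (c + (mj / (mi + mj)) *\<^sub>R w))\<^sup>2 + mj * (norm (c - (mi / (mi + mj)) *\<^sub>R w))\<^sup>2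
         = (mi + mj) * (norm c)\<^sup>2 + mi * mj / (mi + mj) * (norm w)\<^sup>2"
proof -
  define M where "M = mi + mj"
  let ?a = "mj / M" and ?b = "mi / M"
  have M: "M \<noteq> 0" using assms by (simp add: M_def)
  have "mi * (norm (c + ?a *\<^sub>R w))\<^sup>2 + mj * (norm (c - ?b *\<^sub>R w))\<^sup>2
      = (mi + mj) * (c \<bullet> c) + 2 * (mi * ?a - mj * ?b) * (c \<bullet> w)
        + (mi * ?a * ?a + mj * ?b * ?b) * (w \<bullet> w)"
    unfolding power2_norm_eq_inner
    by (simp only: inner_add_left inner_add_right inner_diff_left inner_diff_right
        inner_scaleR_left inner_scaleR_right inner_commute[of w c]) (simp only: algebra_simps)
  \<comment> \<open>The cross term drops out because the two offsets from \<open>c\<close> carry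
    opposite momenta.\<close>
  also have "mi * ?a - mj * ?b = 0"
    by simp
  also have "mi * ?a * ?a + mj * ?b * ?b = mi * mj / M * ((mi + mj) / M)"
    by (simp add: algebra_simps add_divide_distrib)
  finally show ?thesis
    using M by (simp add: power2_norm_eq_inner flip: M_def)
qed

text \<open>The centre-of-mass velocity is the same before and after the collision, so only the
  relative velocity can change the energy. After the collision it is a convex combination, with
  weights \<open>(1 - e) / 2\<close> and \<open>(1 + e) / 2\<close>, of two vectors of length
  \<open>norm (v - vs)\<close>, hence no longer than before.\<close>

lemma energy_dissipation:
  fixes v vs s :: "'a::euclidean_space"
  assumes "mi > 0" "mj > 0" "0 \<le> e" "e \<le> 1" "norm s = 1"
  shows "mi * (norm (post_v mi mj e v vs s))\<^sup>2 + mj * (norm (post_vs mi mj e v vs s))\<^sup>2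
         \<le> mi * (norm v)\<^sup>2 + mj * (norm vs)\<^sup>2"
proof -
  define c where "c = (mi *\<^sub>R v + mj *\<^sub>R vs) /\<^sub>R (mi + mj)"
  define w where "w = ((1 - e) / 2) *\<^sub>R (v - vs) + ((1 + e) / 2 * norm (v - vs)) *\<^sub>R s"
  have M: "mi + mj \<noteq> 0" using assms by simp
  have "norm w \<le> (1 - e) / 2 * norm (v - vs) + (1 + e) / 2 * norm (v - vs)"
    unfolding w_def using assms by (intro norm_triangle_le) (simp add: abs_mult)
  also have "\<dots> = norm (v - vs)"
    by (simp add: field_simps)
  finally have w: "(norm w)\<^sup>2 \<le> (norm (v - vs))\<^sup>2"
    by (simp add: power_mono)
  have 1: "mi / (mi + mj) + mj / (mi + mj) = 1"
    using M by (simp flip: add_divide_distrib)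
  \<comment> \<open>The incoming velocities have the same form with \<open>v - vs\<close> in place
    of \<open>w\<close>, so \<open>energy_center_of_mass\<close> computes both energies.\<close>
  have "c + (mj / (mi + mj)) *\<^sub>R (v - vs) = (mi / (mi + mj) + mj / (mi + mj)) *\<^sub>R v"
    unfolding scaleR_add_left by (simp add: c_def algebra_simps divide_inverse)
  then have v: "v = c + (mj / (mi + mj)) *\<^sub>R (v - vs)"
    unfolding 1 by simp
  have "c - (mi / (mi + mj)) *\<^sub>R (v - vs) = (mi / (mi + mj) + mj / (mi + mj)) *\<^sub>R vs"
    unfolding scaleR_add_left by (simp add: c_def algebra_simps divide_inverse)
  then have vs: "vs = c - (mi / (mi + mj)) *\<^sub>R (v - vs)"
    unfolding 1 by simp
  have "mi * (norm (post_v mi mj e v vs s))\<^sup>2 + mj * (norm (post_vs mi mj e v vs s))\<^sup>2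
      = (mi + mj) * (norm c)\<^sup>2 + mi * mj / (mi + mj) * (norm w)\<^sup>2"
    unfolding post_v_def post_vs_def c_def[symmetric] w_def[symmetric]
    by (rule energy_center_of_mass) (use assms in auto)
  also have "\<dots> \<le> (mi + mj) * (norm c)\<^sup>2 + mi * mj / (mi + mj) * (norm (v - vs))\<^sup>2"
    using assms w by (intro add_left_mono mult_left_mono) auto
  also have "\<dots> = mi * (norm v)\<^sup>2 + mj * (norm vs)\<^sup>2"
    using energy_center_of_mass[of mi mj c "v - vs"] assms v vs by simp
  finally show ?thesis .
qed

section \<open>Strict loss when one particle is at rest\<close>

lemma powr_le_self:
  fixes x p :: real
  assumes "0 \<le> x" "x \<le> 1" "p > 1"
  shows "x powr p \<le> x"
  using powr_mono'[of 1 p x] assms by simp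

lemma powr_less_self:
  fixes x p :: real
  assumes "0 < x" "x < 1" "p > 1"
  shows "x powr p < x"
  using powr_less_mono'[of x 1 p] assms by simp

text \<open>Supplies a direction in which a collision with a resting particle leaves both moving.
  This is where dimension at least two enters: on a line, an elastic collision of equal masses with
  a resting particle only keeps or exchanges the velocities, and nothing is lost.\<close>

lemma exists_unit_orthogonal:
  fixes v :: "'a::euclidean_space"
  assumes "DIM('a) \<ge> 2"
  obtains s where "norm s = 1" "v \<bullet> s = 0"
proof -
  obtain y where "y \<noteq> 0" "orthogonal v y"
    using orthogonal_to_vector_exists[OF assms] by metis
  then show ?thesis
    using that[of "sgn y"] by (auto simp: norm_sgn sgn_div_norm orthogonal_def)
qed

text \<open>At unit energy \<open>x powr p \<le> x\<close>, so energy dissipation alone gives the sign; equality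
  would force all of the energy to stay with one particle.\<close>
lemma q_rest_target_nonpos:
  fixes v s :: "'a::euclidean_space"
  assumes "mi > 0" "mj > 0" "0 \<le> e" "e \<le> 1" "p > 1" "mi * (norm v)\<^sup>2 = 1" "norm s = 1"
  shows "q mi mj e (\<lambda>x. x powr p) v 0 s \<le> 0"
proof -
  let ?x = "mi * (norm (post_v mi mj e v 0 s))\<^sup>2" and ?y = "mj * (norm (post_vs mi mj e v 0 s))\<^sup>2"
  have "?x + ?y \<le> 1" "0 \<le> ?x" "0 \<le> ?y"
    using energy_dissipation[of mi mj e s v 0] assms by auto
  then have "?x powr p \<le> ?x" "?y powr p \<le> ?y" "?x + ?y \<le> 1"
    using assms by (auto intro!: powr_le_self simp del: mult_nonneg_nonneg zero_le_mult_iff)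
  then show ?thesis
    using assms by (simp add: q_def)
qed

lemma q_rest_target_neg:
  fixes v s :: "'a::euclidean_space"
  assumes "mi > 0" "mj > 0" "0 \<le> e" "e \<le> 1" "p > 1" "mi * (norm v)\<^sup>2 = 1" "norm s = 1"
    and orth: "v \<bullet> s = 0"
  shows "q mi mj e (\<lambda>x. x powr p) v 0 s < 0"
proof -
  let ?x = "mi * (norm (post_v mi mj e v 0 s))\<^sup>2" and ?y = "mj * (norm (post_vs mi mj e v 0 s))\<^sup>2"
  have "v \<noteq> 0"
    using assms(6) by force
  then have v: "v \<bullet> v > 0"
    by simp
  \<comment> \<open>Pairing with \<open>v\<close> removes the scattering term; the rest has a
    positive coefficient even for \<open>e = 1\<close>, so the incoming particle is not
    stopped.\<close>
  have "v \<bullet> post_v mi mj e v 0 s = (mi / (mi + mj) + mj / (mi + mj) * ((1 - e) / 2)) * (v \<bullet> v)"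
    unfolding post_v_def by (simp add: inner_add_right orth) (simp add: algebra_simps divide_inverse)
  also have "\<dots> > 0"
    using v assms by (intro mult_pos_pos add_pos_nonneg) auto
  finally have "post_v mi mj e v 0 s \<noteq> 0"
    by (metis inner_zero_right less_irrefl)
  then have "?x > 0"
    using assms(1) by simp
  \<comment> \<open>Pairing with \<open>s\<close> leaves only the scattering term, so the target is
    set in motion.\<close>
  have "s \<bullet> post_vs mi mj e v 0 s = - (mi / (mi + mj)) * ((1 + e) / 2 * norm v) * (s \<bullet> s)"
    unfolding post_vs_def using orth by (simp add: inner_add_right inner_diff_right inner_commute[of s v])
  also have "\<dots> \<noteq> 0"
    using \<open>v \<noteq> 0\<close> assms(1-4,7) by (simp add: dot_square_norm)
  finally have "post_vs mi mj e v 0 s \<noteq> 0"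
    by (metis inner_zero_right)
  then have "?y > 0"
    using assms(2) by simp
  have "?x + ?y \<le> 1"
    using energy_dissipation[of mi mj e s v 0] assms by auto
  \<comment> \<open>Two positive energies with sum at most 1 both lie strictly below 1, where the
    power is strictly smaller than its base.\<close>
  with \<open>?x > 0\<close> \<open>?y > 0\<close> have "?x powr p < ?x" "?y powr p < ?y" "?x + ?y \<le> 1"
    using assms by (auto intro!: powr_less_self simp del: mult_pos_pos zero_less_mult_iff)
  then show ?thesis
    using assms by (simp add: q_def)
qed

section \<open>Symmetry, continuity and scaling of the collision difference\<close>

lemma q_swap: "q mi mj e \<psi> v vs s = q mj mi e \<psi> vs v (- s)"
  by (simp add: q_def post_vs_eq_post_v)

lemma continuous_on_powr_nonneg:
  fixes f :: "'a::topological_space \<Rightarrow> real"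
  assumes "continuous_on S f" "\<And>x. x \<in> S \<Longrightarrow> 0 \<le> f x" "0 < p"
  shows "continuous_on S (\<lambda>x. f x powr p)"
  using assms by (intro continuous_on_powr' continuous_on_const) auto

text \<open>Restricting to \<open>0 \<le> \<eta>\<close> keeps every base nonnegative, and a
  positive exponent makes the power continuous at base zero too. That point occurs when
  \<open>\<eta> = 0\<close> and a particle is at rest.\<close>

lemma continuous_on_q_powr:
  fixes mi mj e p :: real
  assumes "mi > 0" "mj > 0" "p > 0"
  shows "continuous_on ({(\<eta>, v, vs). 0 \<le> \<eta>} \<times> (UNIV :: 'a::euclidean_space set))
    (\<lambda>((\<eta>, v, vs), s). q mi mj e (\<lambda>x. (\<eta> + x) powr p) v vs s)"
  unfolding q_def post_v_def post_vs_def case_prod_unfold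
  by (intro continuous_on_add continuous_on_diff continuous_on_powr_nonneg continuous_on_mult
        continuous_on_power continuous_on_norm continuous_on_const continuous_on_scaleR
        continuous_on_fst continuous_on_snd continuous_on_id)
     (use assms in auto)

text \<open>The collision map is homogeneous of degree one in the velocities, so energies scale by
  \<open>l\<^sup>2\<close>; scaling the shift \<open>\<eta>\<close> by the same factor makes each
  base homogeneous.\<close>

lemma q_powr_scale:
  fixes v vs s :: "'a::euclidean_space"
  assumes "0 \<le> l" "mi > 0" "mj > 0" "0 \<le> \<eta>"
  shows "q mi mj e (\<lambda>x. (l\<^sup>2 * \<eta> + x) powr p) (l *\<^sub>R v) (l *\<^sub>R vs) s
         = l powr (2 * p) * q mi mj e (\<lambda>x. (\<eta> + x) powr p) v vs s"
proof -
  have d: "norm (l *\<^sub>R v - l *\<^sub>R vs) = l * norm (v - vs)"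
    using assms(1) by (simp flip: scaleR_diff_right)
  have 1: "post_v mi mj e (l *\<^sub>R v) (l *\<^sub>R vs) s = l *\<^sub>R post_v mi mj e v vs s"
    unfolding post_v_def d by (simp add: scaleR_add_right scaleR_diff_right ac_simps)
  have 2: "post_vs mi mj e (l *\<^sub>R v) (l *\<^sub>R vs) s = l *\<^sub>R post_vs mi mj e v vs s"
    unfolding post_vs_def d by (simp add: scaleR_add_right scaleR_diff_right ac_simps)
  have 3: "(l\<^sup>2 * \<eta> + m * (norm (l *\<^sub>R x))\<^sup>2) powr p = l powr (2 * p) * (\<eta> + m * (norm x)\<^sup>2) powr p"
    if "m > 0" for m and x :: 'a
    using powr_scale_square[of l \<eta> "m * (norm x)\<^sup>2" p] assms that
    by (simp add: power_mult_distrib ac_simps)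
  show ?thesis
    unfolding q_def 1 2 using assms 3 by (simp add: algebra_simps)
qed

section \<open>The estimate at unit energy and its homogeneous extension\<close>

text \<open>These inequalities turn the constant and the product term of the unit-energy estimate
  into the final powers. The first holds since \<open>a\<close> and \<open>c\<close> are at most
  \<open>l\<close>. For the second, \<open>l\<close> is at most twice the larger of the two, and the
  summand carrying the high power of that one alone suffices.\<close>

lemma homogeneity_bounds:
  fixes a c l p :: real
  assumes "0 \<le> a" "0 \<le> c" "0 < l" "l\<^sup>2 = a\<^sup>2 + c\<^sup>2" "1 < p"
  shows "a powr (2 * p + 1) + c powr (2 * p + 1) \<le> 2 * l powr (2 * p + 1)"
    and "l powr (2 * p + 1) * (a / l * (c / l))
         \<le> 2 powr (2 * p - 1) * (a * c powr (2 * p) + a powr (2 * p) * c)"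
proof -
  have "a \<le> l" "c \<le> l"
    using assms by (auto intro: power2_le_imp_le)
  then have "a powr (2 * p + 1) \<le> l powr (2 * p + 1)" "c powr (2 * p + 1) \<le> l powr (2 * p + 1)"
    using assms by (auto intro: powr_mono2)
  then show "a powr (2 * p + 1) + c powr (2 * p + 1) \<le> 2 * l powr (2 * p + 1)"
    by simp
  have aux: "l powr (2 * p - 1) * (x * y) \<le> 2 powr (2 * p - 1) * (x * y powr (2 * p))"
    if "0 \<le> x" "x \<le> y" "l\<^sup>2 = x\<^sup>2 + y\<^sup>2" for x y
  proof -
    have "x\<^sup>2 \<le> y\<^sup>2"
      using that by (intro power_mono) auto
    moreover have "(2 * y)\<^sup>2 = 4 * y\<^sup>2"
      by (simp add: power_mult_distrib)
    ultimately have "l\<^sup>2 \<le> (2 * y)\<^sup>2"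
      using that(3) zero_le_power2[of y] by linarith
    then have "l \<le> 2 * y"
      by (rule power2_le_imp_le) (use that in simp)
    then have "l powr (2 * p - 1) \<le> (2 * y) powr (2 * p - 1)"
      using assms by (intro powr_mono2) auto
    also have "\<dots> = 2 powr (2 * p - 1) * y powr (2 * p - 1)"
      using that by (simp add: powr_mult)
    finally have "l powr (2 * p - 1) * (x * y) \<le> 2 powr (2 * p - 1) * y powr (2 * p - 1) * (x * y)"
      using that by (intro mult_right_mono) auto
    also have "y powr (2 * p - 1) * y = y powr (2 * p)"
      using that by (cases "y = 0") (auto simp flip: powr_add simp: powr_mult_base mult.commute)
    then have "2 powr (2 * p - 1) * y powr (2 * p - 1) * (x * y)
        = 2 powr (2 * p - 1) * (x * y powr (2 * p))"
      by (simp add: ac_simps)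
    finally show ?thesis .
  qed
  \<comment> \<open>Splitting off \<open>l\<^sup>2\<close> cancels the two denominators.\<close>
  have "l powr (2 * p + 1) = l powr ((2 * p - 1) + 2)"
    by (simp add: algebra_simps)
  also have "\<dots> = l powr (2 * p - 1) * l\<^sup>2"
    using assms(3) by (subst powr_add) simp
  finally have "l powr (2 * p + 1) * (a / l * (c / l)) = l powr (2 * p - 1) * (a * c)"
    using assms(3) by (simp add: power2_eq_square)
  also have "\<dots> \<le> 2 powr (2 * p - 1) * (a * c powr (2 * p) + a powr (2 * p) * c)"
  proof (cases "a \<le> c")
    case True
    have "0 \<le> 2 powr (2 * p - 1) * (a powr (2 * p) * c)"
      using assms by simp
    then show ?thesis
      using aux[of a c] True assms unfolding distrib_left by linarith
  next
    case False
    have "0 \<le> 2 powr (2 * p - 1) * (a * c powr (2 * p))"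
      using assms by simp
    then show ?thesis
      using aux[of c a] False assms unfolding distrib_left mult.commute[of c] by linarith
  qed
  finally show "l powr (2 * p + 1) * (a / l * (c / l))
      \<le> 2 powr (2 * p - 1) * (a * c powr (2 * p) + a powr (2 * p) * c)" .
qed

text \<open>Replacing the weight by \<open>\<beta>2\<close> on gains and by \<open>\<beta>1\<close> on losses makes the bound continuous
  in the velocities, although the weight itself is only measurable.\<close>
lemma q_integral_unit_energy:
  fixes mi mj e p \<beta>1 \<beta>2 :: real
  assumes dim: "DIM('a::euclidean_space) \<ge> 2"
    and mass: "mi > 0" "mj > 0"
    and e: "0 \<le> e" "e \<le> 1" and p: "p > 1"
    and \<beta>: "0 < \<beta>1" "\<beta>1 \<le> \<beta>2"
  obtains k A where "k > 0" "A > 0"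
    "\<And>\<eta> w. \<And>v vs :: 'a. 0 \<le> \<eta> \<Longrightarrow> 2 * \<eta> + mi * (norm v)\<^sup>2 + mj * (norm vs)\<^sup>2 = 1 \<Longrightarrow>
       w \<in> borel_measurable sphere_measure \<Longrightarrow>
       (\<And>s. s \<in> sphere 0 1 \<Longrightarrow> \<beta>1 \<le> w s \<and> w s \<le> \<beta>2) \<Longrightarrow>
       norm (v - vs) * (\<integral>s. q mi mj e (\<lambda>x. (\<eta> + x) powr p) v vs s * w s \<partial>sphere_measure)
       \<le> - k + A * (sqrt (\<eta> + mi * (norm v)\<^sup>2) * sqrt (\<eta> + mj * (norm vs)\<^sup>2))"
proof -
  \<comment> \<open>The box makes compactness immediate; the energy equation with
    \<open>0 \<le> \<eta>\<close> already forces membership in it, as the characterization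
    \<open>K\<close> below shows.\<close>
  define K :: "(real \<times> 'a \<times> 'a) set" where
    "K = ({0..1} \<times> cball 0 (1 / sqrt mi) \<times> cball 0 (1 / sqrt mj)) \<inter>
         {z. 2 * fst z + mi * (norm (fst (snd z)))\<^sup>2 + mj * (norm (snd (snd z)))\<^sup>2 = 1}"
  have "compact K"
    unfolding K_def
    by (intro compact_Int_closed compact_Times closed_Collect_eq continuous_intros) auto
  have bound: "norm x \<le> 1 / sqrt m" if "m * (norm x)\<^sup>2 \<le> 1" "m > 0" for m and x :: 'a
  proof -
    have "(norm x)\<^sup>2 \<le> (1 / sqrt m)\<^sup>2"
      using that by (simp add: power_divide field_simps)
    then show ?thesis
      using that by (auto intro: power2_le_imp_le)
  qed
  have K: "(\<eta>, v, vs) \<in> K \<longleftrightarrow> 0 \<le> \<eta> \<and> 2 * \<eta> + mi * (norm v)\<^sup>2 + mj * (norm vs)\<^sup>2 = 1"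
    for \<eta> v vs
  proof
    assume *: "0 \<le> \<eta> \<and> 2 * \<eta> + mi * (norm v)\<^sup>2 + mj * (norm vs)\<^sup>2 = 1"
    moreover have "0 \<le> mi * (norm v)\<^sup>2" "0 \<le> mj * (norm vs)\<^sup>2"
      using mass by auto
    ultimately have "\<eta> \<le> 1" "mi * (norm v)\<^sup>2 \<le> 1" "mj * (norm vs)\<^sup>2 \<le> 1"
      by linarith+
    with * bound[of mi v] bound[of mj vs] mass show "(\<eta>, v, vs) \<in> K"
      by (auto simp: K_def)
  qed (auto simp: K_def)
  define Q where "Q = (\<lambda>(\<eta>, v, vs :: 'a) s. q mi mj e (\<lambda>x. (\<eta> + x) powr p) v vs s)"
  define \<Phi> where "\<Phi> = (\<lambda>t. max (\<beta>1 * t) (\<beta>2 * t))"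
  have Q: "continuous_on (K \<times> sphere 0 1) (\<lambda>(z, s). Q z s)"
  proof -
    have "K \<times> sphere 0 1 \<subseteq> {(\<eta>, v, vs). 0 \<le> \<eta>} \<times> UNIV"
      by (auto simp: K_def)
    then show ?thesis
      using continuous_on_subset[OF continuous_on_q_powr[of mi mj p e]] mass p
      by (simp add: Q_def case_prod_unfold)
  qed
  have \<Phi>Q: "continuous_on (K \<times> sphere 0 1) (\<lambda>(z, s). \<Phi> (Q z s))"
    using Q unfolding \<Phi>_def case_prod_unfold by (intro continuous_intros)
  have slice: "continuous_on (sphere 0 1) (f z)"
    if "continuous_on (K \<times> sphere 0 1) (\<lambda>(z, s). f z s)" "z \<in> K" for f :: "_ \<Rightarrow> 'a \<Rightarrow> real" and z
    using continuous_on_compose2[OF that(1), of "sphere 0 1" "Pair z"] that(2)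
    by (auto simp: continuous_on_Pair)
  define F where "F = (\<lambda>z. norm (fst (snd z) - snd (snd z)) * (\<integral>s. \<Phi> (Q z s) \<partial>sphere_measure))"
  define g where "g = (\<lambda>(\<eta>, v :: 'a, vs :: 'a). sqrt (\<eta> + mi * (norm v)\<^sup>2) * sqrt (\<eta> + mj * (norm vs)\<^sup>2))"
  have F: "continuous_on K F"
    unfolding F_def
    by (intro continuous_intros continuous_on_sphere_integral \<open>compact K\<close> \<Phi>Q)
  have g: "continuous_on K g"
    unfolding g_def case_prod_unfold by (intro continuous_intros)
  have \<Phi>_nonpos: "\<Phi> t \<le> 0" if "t \<le> 0" for t
    using that \<beta> by (simp add: \<Phi>_def mult_nonneg_nonpos)
  have \<Phi>_neg: "\<Phi> t < 0" if "t < 0" for t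
    using that \<beta> by (simp add: \<Phi>_def mult_pos_neg)
  have neg: "F z < 0" if "z \<in> K" "g z = 0" for z
  proof -
    obtain \<eta> v vs where z: "z = (\<eta>, v, vs)"
      by (metis prod.exhaust)
    have zK: "0 \<le> \<eta>" "2 * \<eta> + mi * (norm v)\<^sup>2 + mj * (norm vs)\<^sup>2 = 1"
      using that(1) unfolding z K by auto
    \<comment> \<open>One factor of \<open>g\<close> vanishes, and its summands are nonnegative; so
      \<open>\<eta> = 0\<close>, one particle rests, and the other has energy 1.\<close>
    have "\<eta> + mi * (norm v)\<^sup>2 = 0 \<or> \<eta> + mj * (norm vs)\<^sup>2 = 0"
      using that(2) by (simp add: z g_def)
    moreover have "0 \<le> mi * (norm v)\<^sup>2" "0 \<le> mj * (norm vs)\<^sup>2"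
      using mass by auto
    ultimately have \<eta>: "\<eta> = 0" and "mi * (norm v)\<^sup>2 = 0 \<or> mj * (norm vs)\<^sup>2 = 0"
      using zK(1) by linarith+
    then consider "v = 0" "mj * (norm vs)\<^sup>2 = 1" | "vs = 0" "mi * (norm v)\<^sup>2 = 1"
      using mass zK by auto
    \<comment> \<open>Distinct velocities keep the prefactor of the integral in \<open>F\<close>
      positive; the other two facts are the input for \<open>sphere_integral_neg\<close>.\<close>
    then have "v \<noteq> vs \<and> (\<forall>s. norm s = 1 \<longrightarrow> Q z s \<le> 0) \<and> (\<exists>s. norm s = 1 \<and> Q z s < 0)"
    proof cases
      case 1
      obtain s where "norm s = 1" "vs \<bullet> s = 0"
        using exists_unit_orthogonal[OF dim] by blast
      \<comment> \<open>Relabelling the particles by \<open>q_swap\<close> turns \<open>s\<close>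
        into \<open>- s\<close>, which is why the witness is negated.\<close>
      then have "norm (- s) = 1 \<and> Q z (- s) < 0"
        using q_rest_target_neg[of mj mi e p vs s] 1 mass e p
        by (simp add: Q_def z \<eta> q_swap[of mi])
      moreover have "Q z s \<le> 0" if "norm s = 1" for s
        using q_rest_target_nonpos[of mj mi e p vs "- s"] 1 mass e p that
        by (simp add: Q_def z \<eta> q_swap[of mi])
      moreover have "v \<noteq> vs"
        using 1 by auto
      ultimately show ?thesis by blast
    next
      case 2
      obtain s where "norm s = 1" "v \<bullet> s = 0"
        using exists_unit_orthogonal[OF dim] by blast
      then have "norm s = 1 \<and> Q z s < 0"
        using q_rest_target_neg[of mi mj e p v s] 2 mass e p by (simp add: Q_def z \<eta>)
      moreover have "Q z s \<le> 0" if "norm s = 1" for s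
        using q_rest_target_nonpos[of mi mj e p v s] 2 mass e p that by (simp add: Q_def z \<eta>)
      moreover have "v \<noteq> vs"
        using 2 by auto
      ultimately show ?thesis by blast
    qed
    then obtain s0 where "v \<noteq> vs" "\<And>s. norm s = 1 \<Longrightarrow> Q z s \<le> 0" "norm s0 = 1" "Q z s0 < 0"
      by blast
    then have "(\<integral>s. \<Phi> (Q z s) \<partial>sphere_measure) < 0"
      using slice[OF \<Phi>Q that(1)]
      by (intro sphere_integral_neg[of _ s0]) (auto intro: \<Phi>_nonpos \<Phi>_neg)
    then show ?thesis
      using \<open>v \<noteq> vs\<close> unfolding F_def z by (simp add: mult_pos_neg)
  qed
  have g_nonneg: "0 \<le> g z" if "z \<in> K" for z
    using that mass by (cases z) (simp add: K g_def)
  obtain k A where kA: "k > 0" "A > 0" "\<And>z. z \<in> K \<Longrightarrow> F z \<le> - k + A * g z"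
    using compact_le_neg_const_plus_mult[OF \<open>compact K\<close> F g g_nonneg neg] by blast
  show thesis
  proof (rule that[OF kA(1,2)])
    fix \<eta> and w :: "'a \<Rightarrow> real" and v vs :: 'a
    assume "0 \<le> \<eta>" "2 * \<eta> + mi * (norm v)\<^sup>2 + mj * (norm vs)\<^sup>2 = 1"
      and w: "w \<in> borel_measurable sphere_measure"
        "\<And>s. s \<in> sphere 0 1 \<Longrightarrow> \<beta>1 \<le> w s \<and> w s \<le> \<beta>2"
    then have z: "(\<eta>, v, vs) \<in> K" (is "?z \<in> K")
      by (simp add: K)
    have bdd: "\<exists>C. \<forall>s\<in>sphere 0 1. \<bar>f s\<bar> \<le> C" if "continuous_on (sphere 0 1) f" for f :: "'a \<Rightarrow> real"
      using compact_imp_bounded[OF compact_continuous_image[OF that compact_sphere]]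
      unfolding bounded_iff real_norm_def by blast
    obtain C where C: "\<And>s. s \<in> sphere 0 1 \<Longrightarrow> \<bar>Q ?z s\<bar> \<le> C"
      using bdd[OF slice[OF Q z]] by blast
    have "integrable sphere_measure (\<lambda>s. Q ?z s * w s)"
    proof (rule integrable_sphere_bounded)
      show "(\<lambda>s. Q ?z s * w s) \<in> borel_measurable sphere_measure"
        using w(1) borel_measurable_sphere_continuous[OF slice[OF Q z]] by measurable
      show "\<bar>Q ?z s * w s\<bar> \<le> C * \<beta>2" if "s \<in> sphere 0 1" for s
        unfolding abs_mult using C[OF that] w(2)[OF that] \<beta> by (intro mult_mono) auto
    qed
    moreover obtain D where D: "\<And>s. s \<in> sphere 0 1 \<Longrightarrow> \<bar>\<Phi> (Q ?z s)\<bar> \<le> D"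
      using bdd[OF slice[OF \<Phi>Q z]] by blast
    have "integrable sphere_measure (\<lambda>s. \<Phi> (Q ?z s))"
      by (rule integrable_sphere_bounded[OF borel_measurable_sphere_continuous[OF slice[OF \<Phi>Q z]] D])
    \<comment> \<open>The largest admissible weight is the worst for \<open>t \<ge> 0\<close>, the
      smallest for \<open>t < 0\<close>.\<close>
    moreover have "t * c \<le> \<Phi> t" if "\<beta>1 \<le> c" "c \<le> \<beta>2" for t c
      using mult_left_mono[of c \<beta>2 t] mult_left_mono_neg[of \<beta>1 c t] that
      by (cases "0 \<le> t") (auto simp: \<Phi>_def mult.commute)
    ultimately have "(\<integral>s. Q ?z s * w s \<partial>sphere_measure) \<le> (\<integral>s. \<Phi> (Q ?z s) \<partial>sphere_measure)"
      using w(2) by (intro integral_mono) auto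
    then have "norm (v - vs) * (\<integral>s. Q ?z s * w s \<partial>sphere_measure) \<le> F ?z"
      by (simp add: F_def mult_left_mono)
    also have "F ?z \<le> - k + A * g ?z"
      by (rule kA(3)[OF z])
    finally show "norm (v - vs) * (\<integral>s. q mi mj e (\<lambda>x. (\<eta> + x) powr p) v vs s * w s \<partial>sphere_measure)
       \<le> - k + A * (sqrt (\<eta> + mi * (norm v)\<^sup>2) * sqrt (\<eta> + mj * (norm vs)\<^sup>2))"
      by (simp add: Q_def g_def)
  qed
qed

text \<open>Dividing the velocities by \<open>l = sqrt (a\<^sup>2 + c\<^sup>2)\<close> and
  \<open>\<eta>\<close> by \<open>l\<^sup>2\<close> reaches unit energy. The integrand returns a
  factor \<open>l powr (2 * p)\<close> and the relative speed one more \<open>l\<close>. Since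
  \<open>w\<close> is arbitrary, the weight belonging to the original velocities is kept
  unchanged.\<close>

lemma q_integral_bound:
  fixes mi mj e p \<beta>1 \<beta>2 :: real
  assumes dim: "DIM('a::euclidean_space) \<ge> 2"
    and mass: "mi > 0" "mj > 0"
    and e: "0 \<le> e" "e \<le> 1" and p: "p > 1"
    and \<beta>: "0 < \<beta>1" "\<beta>1 \<le> \<beta>2"
  obtains k A where "k > 0" "A > 0"
    "\<And>\<eta> a c w. \<And>v vs :: 'a. 0 \<le> \<eta> \<Longrightarrow>
       a = sqrt (\<eta> + mi * (norm v)\<^sup>2) \<Longrightarrow> c = sqrt (\<eta> + mj * (norm vs)\<^sup>2) \<Longrightarrow>
       w \<in> borel_measurable sphere_measure \<Longrightarrow>
       (\<And>s. s \<in> sphere 0 1 \<Longrightarrow> \<beta>1 \<le> w s \<and> w s \<le> \<beta>2) \<Longrightarrow>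
       norm (v - vs) * (\<integral>s. q mi mj e (\<lambda>x. (\<eta> + x) powr p) v vs s * w s \<partial>sphere_measure)
       \<le> - k * (a powr (2 * p + 1) + c powr (2 * p + 1))
         + A * (a * c powr (2 * p) + a powr (2 * p) * c)"
proof -
  obtain k A where kA: "k > 0" "A > 0"
    "\<And>\<eta> w. \<And>v vs :: 'a. 0 \<le> \<eta> \<Longrightarrow> 2 * \<eta> + mi * (norm v)\<^sup>2 + mj * (norm vs)\<^sup>2 = 1 \<Longrightarrow>
       w \<in> borel_measurable sphere_measure \<Longrightarrow>
       (\<And>s. s \<in> sphere 0 1 \<Longrightarrow> \<beta>1 \<le> w s \<and> w s \<le> \<beta>2) \<Longrightarrow>
       norm (v - vs) * (\<integral>s. q mi mj e (\<lambda>x. (\<eta> + x) powr p) v vs s * w s \<partial>sphere_measure)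
       \<le> - k + A * (sqrt (\<eta> + mi * (norm v)\<^sup>2) * sqrt (\<eta> + mj * (norm vs)\<^sup>2))"
    using q_integral_unit_energy[OF assms] by blast
  show thesis
  \<comment> \<open>The factors 2 and \<open>2 powr (2 * p - 1)\<close> are those lost in
    \<open>homogeneity_bounds\<close>.\<close>
  proof (rule that[of "k / 2" "A * 2 powr (2 * p - 1)"])
    fix \<eta> a c and w :: "'a \<Rightarrow> real" and v vs :: 'a
    assume \<eta>: "0 \<le> \<eta>"
      and a: "a = sqrt (\<eta> + mi * (norm v)\<^sup>2)" and c: "c = sqrt (\<eta> + mj * (norm vs)\<^sup>2)"
      and w: "w \<in> borel_measurable sphere_measure"
        "\<And>s. s \<in> sphere 0 1 \<Longrightarrow> \<beta>1 \<le> w s \<and> w s \<le> \<beta>2"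
    have nonneg: "0 \<le> mi * (norm v)\<^sup>2" "0 \<le> mj * (norm vs)\<^sup>2"
      using mass by auto
    define l where "l = sqrt (2 * \<eta> + mi * (norm v)\<^sup>2 + mj * (norm vs)\<^sup>2)"
    have l2: "l\<^sup>2 = 2 * \<eta> + mi * (norm v)\<^sup>2 + mj * (norm vs)\<^sup>2"
      using \<eta> nonneg by (simp add: l_def)
    have ac: "0 \<le> a" "0 \<le> c" "l\<^sup>2 = a\<^sup>2 + c\<^sup>2"
      using \<eta> nonneg by (auto simp: a c l2)
    let ?I = "norm (v - vs) * (\<integral>s. q mi mj e (\<lambda>x. (\<eta> + x) powr p) v vs s * w s \<partial>sphere_measure)"
    show "?I \<le> - (k / 2) * (a powr (2 * p + 1) + c powr (2 * p + 1))
         + A * 2 powr (2 * p - 1) * (a * c powr (2 * p) + a powr (2 * p) * c)"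
    proof (cases "l = 0")
      \<comment> \<open>No normalization is possible here, but both velocities vanish and both sides
        are 0.\<close>
      case True
      then have "a = 0" "c = 0"
        using ac(3) by (auto simp: add_nonneg_eq_0_iff)
      moreover have "2 * \<eta> + mi * (norm v)\<^sup>2 + mj * (norm vs)\<^sup>2 = 0"
        using True l2 by simp
      then have "mi * (norm v)\<^sup>2 = 0" "mj * (norm vs)\<^sup>2 = 0"
        using \<eta> nonneg by linarith+
      then have "v = 0" "vs = 0"
        using mass by auto
      ultimately show ?thesis by simp
    next
      case False
      then have l: "0 < l"
        using \<eta> nonneg by (simp add: l_def)
      define \<eta>' v' vs' where "\<eta>' = \<eta> / l\<^sup>2" and "v' = v /\<^sub>R l" and "vs' = vs /\<^sub>R l"
      have eqs: "\<eta> = l\<^sup>2 * \<eta>'" "v = l *\<^sub>R v'" "vs = l *\<^sub>R vs'"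
        using l by (auto simp: \<eta>'_def v'_def vs'_def)
      have \<eta>': "0 \<le> \<eta>'"
        using \<eta> by (simp add: \<eta>'_def)
      have "l\<^sup>2 * (2 * \<eta>' + mi * (norm v')\<^sup>2 + mj * (norm vs')\<^sup>2) = l\<^sup>2 * 1"
        using l2 unfolding eqs by (simp add: power_mult_distrib algebra_simps)
      then have unit: "2 * \<eta>' + mi * (norm v')\<^sup>2 + mj * (norm vs')\<^sup>2 = 1"
        using l by simp
      have "\<eta> + m * (norm (l *\<^sub>R x))\<^sup>2 = l\<^sup>2 * (\<eta>' + m * (norm x)\<^sup>2)" for m and x :: 'a
        by (simp add: eqs(1) power_mult_distrib algebra_simps)
      then have "a = l * sqrt (\<eta>' + mi * (norm v')\<^sup>2)" "c = l * sqrt (\<eta>' + mj * (norm vs')\<^sup>2)"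
        unfolding a c eqs(2,3) using l by (simp_all add: real_sqrt_mult)
      then have a': "sqrt (\<eta>' + mi * (norm v')\<^sup>2) = a / l" and c': "sqrt (\<eta>' + mj * (norm vs')\<^sup>2) = c / l"
        using l by auto
      have "norm (v - vs) = l * norm (v' - vs')"
        unfolding eqs using l by (simp flip: scaleR_diff_right)
      moreover have "q mi mj e (\<lambda>x. (\<eta> + x) powr p) v vs s
          = l powr (2 * p) * q mi mj e (\<lambda>x. (\<eta>' + x) powr p) v' vs' s" for s
        unfolding eqs using l mass \<eta>' by (intro q_powr_scale) auto
      then have "(\<integral>s. q mi mj e (\<lambda>x. (\<eta> + x) powr p) v vs s * w s \<partial>sphere_measure)
          = l powr (2 * p) * (\<integral>s. q mi mj e (\<lambda>x. (\<eta>' + x) powr p) v' vs' s * w s \<partial>sphere_measure)"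
        by (simp add: mult.assoc)
      ultimately have "?I = l * l powr (2 * p) * (norm (v' - vs') *
          (\<integral>s. q mi mj e (\<lambda>x. (\<eta>' + x) powr p) v' vs' s * w s \<partial>sphere_measure))"
        by (simp only: ac_simps)
      also have "\<dots> \<le> l * l powr (2 * p) * (- k + A * (a / l * (c / l)))"
        using kA(3)[OF \<eta>' unit w] l unfolding a' c' by (intro mult_left_mono) auto
      also have "l * l powr (2 * p) = l powr (2 * p + 1)"
        using l by (simp add: powr_add)
      also have "l powr (2 * p + 1) * (- k + A * (a / l * (c / l)))
          = - (k / 2) * (2 * l powr (2 * p + 1)) + A * (l powr (2 * p + 1) * (a / l * (c / l)))"
        by (simp add: algebra_simps)
      also have "\<dots> \<le> - (k / 2) * (a powr (2 * p + 1) + c powr (2 * p + 1))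
         + A * (2 powr (2 * p - 1) * (a * c powr (2 * p) + a powr (2 * p) * c))"
        using homogeneity_bounds[OF ac(1,2) l ac(3) p] kA(1,2)
        by (intro add_mono mult_left_mono mult_left_mono_neg) auto
      finally show ?thesis
        by (simp add: mult.assoc)
    qed
  qed (use kA in auto)
qed

section \<open>Mass factors and the two choices of the convex function\<close>

text \<open>Used to absorb mass-dependent coefficients: the loss terms keep the smaller coefficient
  and the gain terms the larger one.\<close>

lemma combination_bound:
  fixes k A a1 a2 c1 c2 :: real
  assumes "0 < k" "0 < A" "0 < a1" "0 < a2" "0 < c1" "0 < c2"
  obtains k' A' where "0 < k'" "0 < A'"
    "\<And>X Y Z T. 0 \<le> X \<Longrightarrow> 0 \<le> Y \<Longrightarrow> 0 \<le> Z \<Longrightarrow> 0 \<le> T \<Longrightarrow>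
       - k * (a1 * X + a2 * Y) + A * (c1 * Z + c2 * T) \<le> - k' * (X + Y) + A' * (Z + T)"
proof (rule that[of "k * min a1 a2" "A * max c1 c2"])
  fix X Y Z T :: real
  assume "0 \<le> X" "0 \<le> Y" "0 \<le> Z" "0 \<le> T"
  then have "min a1 a2 * X + min a1 a2 * Y \<le> a1 * X + a2 * Y"
    "c1 * Z + c2 * T \<le> max c1 c2 * Z + max c1 c2 * T"
    by (auto intro!: add_mono mult_right_mono)
  then have "k * (min a1 a2 * X + min a1 a2 * Y) \<le> k * (a1 * X + a2 * Y)"
    "A * (c1 * Z + c2 * T) \<le> A * (max c1 c2 * Z + max c1 c2 * T)"
    using assms by (auto intro: mult_left_mono)
  then show "- k * (a1 * X + a2 * Y) + A * (c1 * Z + c2 * T)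
      \<le> - (k * min a1 a2) * (X + Y) + A * max c1 c2 * (Z + T)"
    by (simp add: algebra_simps)
qed (use assms in auto)

lemma cos_angle_bounds: "cos_angle x y \<in> {-1..1}"
proof -
  have "\<bar>cos_angle x y\<bar> \<le> 1"
    using Cauchy_Schwarz_ineq2[of x y]
    by (cases "x = 0 \<or> y = 0") (auto simp: cos_angle_def divide_le_eq_1)
  then show ?thesis by auto
qed

theorem lemma4p4:
  fixes mi mj e p \<beta>1 \<beta>2 :: real and b :: "real \<Rightarrow> real"
  assumes dim: "CARD('d::finite) \<ge> 2"
    and mass: "mi > 0" "mj > 0"
    and restitution: "0 \<le> e" "e \<le> 1"
    and p: "p > 1"
    and b_measurable: "b \<in> borel_measurable (restrict_space borel {-1..1})"
    and \<beta>1: "0 < \<beta>1"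
    and b_bounds: "\<And>x. x \<in> {-1..1} \<Longrightarrow> \<beta>1 \<le> b x \<and> b x \<le> \<beta>2"
  shows
    "(\<exists>k>0. \<exists>A>0. \<forall>v vs :: real ^ 'd.
        norm (v - vs) * q_bar mi mj e b (\<lambda>x. x powr p) v vs
        \<le> - k * (mi * norm v powr (2 * p + 1) + mj * norm vs powr (2 * p + 1))
          + A * (mi * mj powr p * norm v * norm vs powr (2 * p)
                 + mj * mi powr p * norm v powr (2 * p) * norm vs))
   \<and> (\<exists>k>0. \<exists>A>0. \<forall>v vs :: real ^ 'd.
        norm (v - vs) * q_bar mi mj e b (\<lambda>x. (1 + x) powr p - 1) v vs
        \<le> - k * (mi * bracket mi v powr (2 * p + 1) + mj * bracket mj vs powr (2 * p + 1))
          + A * (mi * mj powr p * bracket mi v * bracket mj vs powr (2 * p)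
                 + mj * mi powr p * bracket mi v powr (2 * p) * bracket mj vs))"
proof -
  have "\<beta>1 \<le> \<beta>2"
    using b_bounds[of 0] by auto
  have DIM: "DIM(real ^ 'd) \<ge> 2"
    using dim by simp
  obtain k A where kA: "k > 0" "A > 0"
    and est: "\<And>\<eta> a c w. \<And>v vs :: real ^ 'd. 0 \<le> \<eta> \<Longrightarrow>
       a = sqrt (\<eta> + mi * (norm v)\<^sup>2) \<Longrightarrow> c = sqrt (\<eta> + mj * (norm vs)\<^sup>2) \<Longrightarrow>
       w \<in> borel_measurable sphere_measure \<Longrightarrow>
       (\<And>s. s \<in> sphere 0 1 \<Longrightarrow> \<beta>1 \<le> w s \<and> w s \<le> \<beta>2) \<Longrightarrow>
       norm (v - vs) * (\<integral>s. q mi mj e (\<lambda>x. (\<eta> + x) powr p) v vs s * w s \<partial>sphere_measure)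
       \<le> - k * (a powr (2 * p + 1) + c powr (2 * p + 1))
         + A * (a * c powr (2 * p) + a powr (2 * p) * c)"
    using q_integral_bound[OF DIM mass restitution p \<beta>1 \<open>\<beta>1 \<le> \<beta>2\<close>] by blast
  have weight: "(\<lambda>s. b (cos_angle u s)) \<in> borel_measurable sphere_measure" for u :: "real ^ 'd"
  proof (rule measurable_compose[OF _ b_measurable], rule measurable_restrict_space2)
    show "cos_angle u \<in> space sphere_measure \<rightarrow> {-1..1}"
      using cos_angle_bounds by blast
    \<comment> \<open>On the sphere \<open>norm s = 1\<close>, so this is
      \<open>cos_angle u\<close>; for \<open>u = 0\<close> division by zero makes it constantly
      0.\<close>
    have "continuous_on (sphere 0 1) (\<lambda>s. (u \<bullet> s) / norm u)"
      by (cases "u = 0") (auto intro!: continuous_intros)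
    then have "continuous_on (sphere 0 1) (cos_angle u)"
      by (rule continuous_on_eq) (simp add: cos_angle_def)
    then show "cos_angle u \<in> borel_measurable sphere_measure"
      by (rule borel_measurable_sphere_continuous)
  qed
  have bound: "norm (v - vs) * q_bar mi mj e b (\<lambda>x. (\<eta> + x) powr p) v vs
       \<le> - k * (a powr (2 * p + 1) + c powr (2 * p + 1))
         + A * (a * c powr (2 * p) + a powr (2 * p) * c)"
    if "0 \<le> \<eta>" "a = sqrt (\<eta> + mi * (norm v)\<^sup>2)" "c = sqrt (\<eta> + mj * (norm vs)\<^sup>2)"
    for \<eta> a c and v vs :: "real ^ 'd"
    unfolding q_bar_def using that weight b_bounds[OF cos_angle_bounds] by (intro est) auto
  show ?thesis
  proof
    \<comment> \<open>For \<open>\<eta> = 0\<close> the brackets are \<open>sqrt mi * norm v\<close>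
      and \<open>sqrt mj * norm vs\<close>; these ratios compare their powers with the mass factors
      demanded in the claim.\<close>
    have "0 < sqrt mi powr (2 * p + 1) / mi" "0 < sqrt mj powr (2 * p + 1) / mj"
      "0 < sqrt mi * sqrt mj powr (2 * p) / (mi * mj powr p)"
      "0 < sqrt mi powr (2 * p) * sqrt mj / (mj * mi powr p)"
      using mass by auto
    from combination_bound[OF kA this] obtain k' A' where kA': "0 < k'" "0 < A'"
      and comb: "\<And>X Y Z T. 0 \<le> X \<Longrightarrow> 0 \<le> Y \<Longrightarrow> 0 \<le> Z \<Longrightarrow> 0 \<le> T \<Longrightarrow>
       - k * (sqrt mi powr (2 * p + 1) / mi * X + sqrt mj powr (2 * p + 1) / mj * Y)
       + A * (sqrt mi * sqrt mj powr (2 * p) / (mi * mj powr p) * Z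
              + sqrt mi powr (2 * p) * sqrt mj / (mj * mi powr p) * T)
       \<le> - k' * (X + Y) + A' * (Z + T)"
      by blast
    have "norm (v - vs) * q_bar mi mj e b (\<lambda>x. x powr p) v vs
        \<le> - k' * (mi * norm v powr (2 * p + 1) + mj * norm vs powr (2 * p + 1))
          + A' * (mi * mj powr p * norm v * norm vs powr (2 * p)
                 + mj * mi powr p * norm v powr (2 * p) * norm vs)" for v vs :: "real ^ 'd"
    proof -
      have "norm (v - vs) * q_bar mi mj e b (\<lambda>x. (0 + x) powr p) v vs
         \<le> - k * ((sqrt mi * norm v) powr (2 * p + 1) + (sqrt mj * norm vs) powr (2 * p + 1))
         + A * ((sqrt mi * norm v) * (sqrt mj * norm vs) powr (2 * p)
                + (sqrt mi * norm v) powr (2 * p) * (sqrt mj * norm vs))"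
        by (rule bound) (simp_all add: real_sqrt_mult)
      then show ?thesis
        using comb[of "mi * norm v powr (2 * p + 1)" "mj * norm vs powr (2 * p + 1)"
            "mi * mj powr p * norm v * norm vs powr (2 * p)"
            "mj * mi powr p * norm v powr (2 * p) * norm vs"] mass
        by (simp add: powr_mult ac_simps)
    qed
    with kA' show "\<exists>k>0. \<exists>A>0. \<forall>v vs :: real ^ 'd.
        norm (v - vs) * q_bar mi mj e b (\<lambda>x. x powr p) v vs
        \<le> - k * (mi * norm v powr (2 * p + 1) + mj * norm vs powr (2 * p + 1))
          + A * (mi * mj powr p * norm v * norm vs powr (2 * p)
                 + mj * mi powr p * norm v powr (2 * p) * norm vs)"
      by blast
  next
    \<comment> \<open>For \<open>\<eta> = 1\<close> the quantities \<open>a\<close> and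
      \<open>c\<close> are exactly the brackets, so only the mass factors of the claim are divided
      out.\<close>
    have "0 < 1 / mi" "0 < 1 / mj" "0 < 1 / (mi * mj powr p)" "0 < 1 / (mj * mi powr p)"
      using mass by auto
    from combination_bound[OF kA this] obtain k' A' where kA': "0 < k'" "0 < A'"
      and comb: "\<And>X Y Z T. 0 \<le> X \<Longrightarrow> 0 \<le> Y \<Longrightarrow> 0 \<le> Z \<Longrightarrow> 0 \<le> T \<Longrightarrow>
       - k * (1 / mi * X + 1 / mj * Y) + A * (1 / (mi * mj powr p) * Z + 1 / (mj * mi powr p) * T)
       \<le> - k' * (X + Y) + A' * (Z + T)"
      by blast
    have "norm (v - vs) * q_bar mi mj e b (\<lambda>x. (1 + x) powr p - 1) v vs
        \<le> - k' * (mi * bracket mi v powr (2 * p + 1) + mj * bracket mj vs powr (2 * p + 1))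
          + A' * (mi * mj powr p * bracket mi v * bracket mj vs powr (2 * p)
                 + mj * mi powr p * bracket mi v powr (2 * p) * bracket mj vs)"
      for v vs :: "real ^ 'd"
    proof -
      \<comment> \<open>The constant \<open>- 1\<close> enters two terms with each sign and
        cancels.\<close>
      have shift: "q_bar mi mj e b (\<lambda>x. (1 + x) powr p - 1) v vs
          = q_bar mi mj e b (\<lambda>x. (1 + x) powr p) v vs"
      proof -
        have "q mi mj e (\<lambda>x. (1 + x) powr p - 1) v vs s = q mi mj e (\<lambda>x. (1 + x) powr p) v vs s" for s
          by (simp add: q_def)
        then show ?thesis
          by (simp add: q_bar_def)
      qed
      have "0 \<le> bracket mi v" "0 \<le> bracket mj vs"
        using mass by (simp_all add: bracket_def)
      then show ?thesis
        using bound[of 1 "bracket mi v" v "bracket mj vs" vs]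
          comb[of "mi * bracket mi v powr (2 * p + 1)" "mj * bracket mj vs powr (2 * p + 1)"
            "mi * mj powr p * bracket mi v * bracket mj vs powr (2 * p)"
            "mj * mi powr p * bracket mi v powr (2 * p) * bracket mj vs"] mass
        unfolding shift by (simp add: bracket_def)
    qed
    with kA' show "\<exists>k>0. \<exists>A>0. \<forall>v vs :: real ^ 'd.
        norm (v - vs) * q_bar mi mj e b (\<lambda>x. (1 + x) powr p - 1) v vs
        \<le> - k * (mi * bracket mi v powr (2 * p + 1) + mj * bracket mj vs powr (2 * p + 1))
          + A * (mi * mj powr p * bracket mi v * bracket mj vs powr (2 * p)
                 + mj * mi powr p * bracket mi v powr (2 * p) * bracket mj vs)"
      by blast
  qed
qed

end
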